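(* Let $q\in\mathbb{C}^*$ be fixed or seen as a formal parameter. The time $1$ flow of the operator $D_{-1}=(1+(q-1)x)\partial$, seen as a vector field on the hyperbolic plane $\mathbb{H}^2$, is the affine map $$x\mapsto -\frac{1}{q-1}+\left(x+\frac{1}{q-1}\right)e^{q-1},$$ whose Taylor expansion at order $1$ in $q-1$ is $T_q$, where $T_q(x)=qx+1$.
   Context: $\mathbb{H}^2\subset\mathbb{C}$ is the upper half-plane model with coordinate $x\in\mathbb{C}$, and $\partial=\frac{d}{dx}$. The flow of the vector field $p(x)\partial$ starting at $x$ is the curve $\gamma$ with $\gamma'(t)=p(\gamma(t))$ and $\gamma(0)=x$; the time $1$ flow is the map $x\mapsto\gamma(1)$.
   Formalization: The order 1 Taylor expansion is taken only in the factor e^{q-1}, with 1/(q-1) kept; expanding the whole map gives T_q(x)+(q-1)/2. For non-real q the flow on H^2 is partial (curves may leave H^2); at q=1 the affine map is replaced by its limit x+1. *)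

theory Defs
  imports "HOL-Analysis.Analysis" "HOL-Computational_Algebra.Formal_Laurent_Series"
begin

definition hyperbolic_plane :: "complex set" where
  "hyperbolic_plane = {x. Im x > 0}"

text \<open>
  \<open>D_field q\<close> is the coefficient \<open>p\<close> of the vector field \<open>p(x)\<partial>\<close>. It is polymorphic in the ring so
  that \<open>q\<close> can be a complex number or the formal power series \<open>1 + h\<close>.
\<close>

definition D_field :: "'a::comm_ring_1 \<Rightarrow> 'a \<Rightarrow> 'a" where
  "D_field q x = 1 + (q - 1) * x"

definition T_map :: "'a::comm_ring_1 \<Rightarrow> 'a \<Rightarrow> 'a" where
  "T_map q x = q * x + 1"

text \<open>
  The affine map with fixed point \<open>-1/(q-1)\<close> and multiplier \<open>e\<close>; the relevant multiplier is
  \<open>e = exp (q - 1)\<close>. It has its mathematical meaning only for \<open>q \<noteq> 1\<close>.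
\<close>

definition affine_map :: "'a::field \<Rightarrow> 'a \<Rightarrow> 'a \<Rightarrow> 'a" where
  "affine_map q e x = - (1 / (q - 1)) + (x + 1 / (q - 1)) * e"

definition integral_curve_on ::
    "complex set \<Rightarrow> real set \<Rightarrow> (complex \<Rightarrow> complex) \<Rightarrow> complex \<Rightarrow> (real \<Rightarrow> complex) \<Rightarrow> bool" where
  "integral_curve_on S I p x \<gamma> \<longleftrightarrow>
     \<gamma> 0 = x \<and> (\<forall>t\<in>I. \<gamma> t \<in> S \<and> (\<gamma> has_vector_derivative p (\<gamma> t)) (at t within I))"

text \<open>
  A relation rather than a function: for non-real \<open>q\<close> an integral curve can leave the hyperbolic
  plane before time 1, so that the time 1 flow there is only partially defined.
\<close>

definition time_one_flow ::
    "complex set \<Rightarrow> (complex \<Rightarrow> complex) \<Rightarrow> complex \<Rightarrow> complex \<Rightarrow> bool" where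
  "time_one_flow S p x y \<longleftrightarrow> (\<exists>\<gamma>. integral_curve_on S {0..1} p x \<gamma> \<and> \<gamma> 1 = y)"

text \<open>
  For a formal parameter \<open>h = q - 1\<close> the curve takes values in \<open>\<complex>[[h]]\<close> and is differentiated in
  \<open>t\<close> coefficient by coefficient.
\<close>

definition formal_integral_curve ::
    "(complex fps \<Rightarrow> complex fps) \<Rightarrow> complex fps \<Rightarrow> (real \<Rightarrow> complex fps) \<Rightarrow> bool" where
  "formal_integral_curve p x \<gamma> \<longleftrightarrow>
     \<gamma> 0 = x \<and>
     (\<forall>t n. ((\<lambda>s. fps_nth (\<gamma> s) n) has_vector_derivative fps_nth (p (\<gamma> t)) n) (at t))"

definition taylor_polynomial ::
    "nat \<Rightarrow> (complex \<Rightarrow> complex) \<Rightarrow> complex \<Rightarrow> complex \<Rightarrow> complex" where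
  "taylor_polynomial n f c z = (\<Sum>k\<le>n. (deriv ^^ k) f c / fact k * (z - c) ^ k)"

text \<open>
  The order 1 Taylor expansion giving \<open>T_map q\<close> is the one in the exponent \<open>q - 1\<close> of the multiplier,
  the fixed point \<open>-1/(q-1)\<close> being held: \<open>exp (q - 1)\<close> becomes \<open>1 + (q - 1)\<close>. Expanding the
  occurrences \<open>1/(q-1)\<close> as well would give \<open>T_map q x + (q - 1)/2\<close> instead, as shown here with
  \<open>h = q - 1\<close>.
\<close>

lemma full_expansion_order_one:
  fixes x :: complex
  shows "((\<lambda>h. (affine_map (1 + h) (exp h) x - T_map (1 + h) x) / h) \<longlongrightarrow> 1 / 2) (at 0)"
proof -
  define c :: "nat \<Rightarrow> complex" where "c = (\<lambda>n. inverse (fact (n + 2)))"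
  define f where "f = (\<lambda>h. \<Sum>n. c n * h ^ n)"
  have sums: "(\<lambda>n. h ^ 2 * (c n * h ^ n)) sums (exp h - 1 - h)" for h :: complex
  proof -
    have "(\<lambda>n. inverse (fact (n + 2)) * h ^ (n + 2)) sums
        (exp h - (\<Sum>n<2. inverse (fact n) * h ^ n))"
      using sums_split_initial_segment[OF exp_converges[of h], of 2]
      by (simp add: scaleR_conv_of_real)
    then show ?thesis
      by (simp add: c_def numeral_2_eq_2 power_add mult_ac diff_diff_eq)
  qed
  have sm: "summable (\<lambda>n. c n * h ^ n)" if "h \<noteq> 0" for h
    using summable_mult_D[OF sums_summable[OF sums[of h]]] that by simp
  have cont: "isCont f 0"
    unfolding f_def by (rule isCont_powser[OF sm[of 1]]) auto
  have f0: "f 0 = 1 / 2"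
    unfolding f_def by (simp add: powser_zero c_def numeral_2_eq_2)
  have ex: "exp h = 1 + h + h ^ 2 * f h" if "h \<noteq> 0" for h
    using sums_unique2[OF sums[of h] sums_mult[OF summable_sums[OF sm[OF that]], of "h ^ 2"]]
    by (simp add: f_def algebra_simps)
  have "((\<lambda>h. (x * h + 1) * f h) \<longlongrightarrow> (x * 0 + 1) * f 0) (at 0)"
    using cont by (intro tendsto_intros) (simp add: isCont_def)
  then have "((\<lambda>h. (x * h + 1) * f h) \<longlongrightarrow> 1 / 2) (at 0)"
    unfolding f0 by simp
  moreover have eq: "(affine_map (1 + h) (exp h) x - T_map (1 + h) x) / h = (x * h + 1) * f h"
    if "h \<noteq> 0" for h
  proof -
    have "affine_map (1 + h) (exp h) x - T_map (1 + h) x = h * ((x * h + 1) * f h)"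
      using that by (simp add: affine_map_def T_map_def ex[OF that] field_simps power2_eq_square)
    then show ?thesis using that by simp
  qed
  ultimately show ?thesis
    by (simp add: Lim_cong_within[OF refl refl refl eq])
qed

end

theory Submission
  imports Defs
begin

text \<open>The equation \<open>\<gamma>' = 1 + (q - 1) * \<gamma>\<close> is linear with constant
  coefficients. For \<open>q \<noteq> 1\<close>, moving the fixed point \<open>-1/(q-1)\<close> to
  the origin turns it into \<open>u' = (q - 1) * u\<close>, so \<open>x + 1/(q-1)\<close> is
  multiplied by \<open>exp (t * (q - 1))\<close>; for \<open>q = 1\<close> the flow is translation
  by \<open>t\<close>. \<open>D_flow\<close> joins both cases and
  \<open>linear_ode_unique_on\<close> excludes other solutions. Hence a time 1 flow inside a set
  exists exactly when this one curve stays there (\<open>time_one_flow_D_field_iff\<close>); for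
  real \<open>q\<close> it never leaves the half-plane. Replacing the multiplier by
  \<open>1 + (q - 1)\<close> makes the pole cancel and leaves \<open>q * x + 1\<close>.

  For a formal parameter h, the coefficients of a curve obey the triangular system
  \<open>\<gamma>_0' = 1\<close>, \<open>\<gamma>_(n+1)' = \<gamma>_n\<close>, solved uniquely by
  successive integration. The closed form contains 1/h, so it is compared with the solution among
  Laurent series, after checking the identity multiplied by h among power series.\<close>

section \<open>Linear equations and algebra of the affine map\<close>

text \<open>The integrating factor \<open>exp (- c * s)\<close> makes the difference of two
  solutions constant. Derivatives within \<open>I\<close> let the same statement serve
  \<open>{0..1}\<close> and the whole line.\<close>

lemma linear_ode_unique_on:
  fixes \<gamma> \<delta> :: "real \<Rightarrow> complex"
  assumes I: "convex I" "0 \<in> I" and t: "t \<in> I"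
    and \<gamma>: "\<And>s. s \<in> I \<Longrightarrow> (\<gamma> has_vector_derivative a + c * \<gamma> s) (at s within I)"
    and \<delta>: "\<And>s. s \<in> I \<Longrightarrow> (\<delta> has_vector_derivative a + c * \<delta> s) (at s within I)"
    and init: "\<gamma> 0 = \<delta> 0"
  shows "\<gamma> t = \<delta> t"
proof -
  define g where "g = (\<lambda>s. exp (- c * of_real s) * (\<gamma> s - \<delta> s))"
  have E: "((\<lambda>s. exp (- c * of_real s)) has_vector_derivative exp (- c * of_real s) * (- c))
      (at s within I)" for s
    by (rule has_vector_derivative_real_field) (auto intro!: derivative_eq_intros)
  have "(g has_vector_derivative 0) (at s within I)" if "s \<in> I" for s
    unfolding g_def
    by (rule has_vector_derivative_eq_rhs
        [OF has_vector_derivative_mult[OF E has_vector_derivative_diff[OF \<gamma>[OF that] \<delta>[OF that]]]])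
      (simp add: algebra_simps)
  then obtain k where k: "\<And>s. s \<in> I \<Longrightarrow> g s = k"
    using has_vector_derivative_zero_constant[OF I(1), of g] by blast
  have "g t = g 0" using k I(2) t by simp
  then show ?thesis using init by (simp add: g_def)
qed

text \<open>Clearing denominators: the second premise contains no division, so it can be verified in
  a ring where \<open>q - 1\<close> is not invertible and then transferred to a field.\<close>

lemma affine_map_eqI:
  assumes "q \<noteq> 1" "(q - 1) * y = (1 + x * (q - 1)) * e - 1"
  shows "y = affine_map q e x"
proof -
  define c where "c = q - 1"
  have c: "c \<noteq> 0" "c * y = (1 + x * c) * e - 1"
    using assms by (simp_all add: c_def)
  then have "c * y = c * (- (1 / c) + (x + 1 / c) * e)"
    by (simp add: algebra_simps)
  with c(1) show ?thesis
    by (simp add: affine_map_def c_def)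
qed

text \<open>The field vanishes at \<open>-1/(q-1)\<close>, so in the coordinate centred there it is
  multiplication by \<open>q - 1\<close>. The right side has the shape produced by differentiating
  \<open>exp (t * (q - 1))\<close>.\<close>

lemma D_field_affine_map:
  assumes "q \<noteq> 1"
  shows "D_field q (affine_map q e x) = (x + 1 / (q - 1)) * (e * (q - 1))"
proof -
  define c where "c = q - 1"
  have "c \<noteq> 0"
    using assms by (simp add: c_def)
  then have "1 + c * (- (1 / c) + (x + 1 / c) * e) = (x + 1 / c) * (e * c)"
    by (simp add: algebra_simps)
  then show ?thesis
    by (simp add: affine_map_def D_field_def c_def)
qed

section \<open>The flow for a complex parameter\<close>

text \<open>The case \<open>q = 1\<close> is separate because \<open>1 / 0 = 0\<close> would turn
  the affine formula into the constant curve \<open>x\<close> instead of a translation.\<close>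

definition D_flow :: "complex \<Rightarrow> complex \<Rightarrow> real \<Rightarrow> complex" where
  "D_flow q x t =
     (if q = 1 then x + of_real t else affine_map q (exp (of_real t * (q - 1))) x)"

lemma D_flow_0: "D_flow q x 0 = x"
  by (simp add: D_flow_def affine_map_def)

lemma D_flow_1: "q \<noteq> 1 \<Longrightarrow> D_flow q x 1 = affine_map q (exp (q - 1)) x"
  by (simp add: D_flow_def)

lemma D_flow_has_vector_derivative:
  "(D_flow q x has_vector_derivative D_field q (D_flow q x t)) (at t within I)"
proof (cases "q = 1")
  case True
  then have "D_flow q x = (\<lambda>t. x + of_real t)"
    by (simp add: D_flow_def fun_eq_iff)
  moreover have "((\<lambda>t. x + of_real t) has_vector_derivative 1) (at t within I)"
    by (rule has_vector_derivative_real_field) (auto intro!: derivative_eq_intros)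
  ultimately show ?thesis
    using True by (simp add: D_field_def)
next
  case False
  then have eq: "D_flow q x = (\<lambda>t. affine_map q (exp (of_real t * (q - 1))) x)"
    by (simp add: D_flow_def fun_eq_iff)
  have "((\<lambda>t. affine_map q (exp (of_real t * (q - 1))) x) has_vector_derivative
      (x + 1 / (q - 1)) * (exp (of_real t * (q - 1)) * (q - 1))) (at t within I)"
    unfolding affine_map_def
    by (rule has_vector_derivative_real_field) (auto intro!: derivative_eq_intros)
  then show ?thesis
    unfolding eq D_field_affine_map[OF False] .
qed

lemma integral_curve_on_D_flow:
  assumes "\<And>t. t \<in> I \<Longrightarrow> D_flow q x t \<in> S"
  shows "integral_curve_on S I (D_field q) x (D_flow q x)"
  using assms by (simp add: integral_curve_on_def D_flow_0 D_flow_has_vector_derivative)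

lemma integral_curve_on_D_field_unique:
  assumes "convex I" "0 \<in> I" "t \<in> I" "integral_curve_on S I (D_field q) x \<gamma>"
  shows "\<gamma> t = D_flow q x t"
  using assms D_flow_has_vector_derivative[of q x _ I]
  by (intro linear_ode_unique_on[of I t \<gamma> 1 "q - 1" "D_flow q x"])
    (auto simp: integral_curve_on_def D_field_def D_flow_0)

text \<open>By uniqueness any witness curve agrees with \<open>D_flow\<close> on
  \<open>{0..1}\<close>, so the set \<open>S\<close> enters only through whether
  \<open>D_flow\<close> stays in it.\<close>

lemma time_one_flow_D_field_iff:
  "time_one_flow S (D_field q) x y \<longleftrightarrow> (\<forall>t\<in>{0..1}. D_flow q x t \<in> S) \<and> y = D_flow q x 1"
proof
  assume "time_one_flow S (D_field q) x y"
  then obtain \<gamma> where \<gamma>: "integral_curve_on S {0..1} (D_field q) x \<gamma>" "\<gamma> 1 = y"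
    by (auto simp: time_one_flow_def)
  have "\<gamma> t = D_flow q x t" if "t \<in> {0..1}" for t
    using integral_curve_on_D_field_unique[OF _ _ that \<gamma>(1)] by simp
  with \<gamma> show "(\<forall>t\<in>{0..1}. D_flow q x t \<in> S) \<and> y = D_flow q x 1"
    by (force simp: integral_curve_on_def)
next
  assume "(\<forall>t\<in>{0..1}. D_flow q x t \<in> S) \<and> y = D_flow q x 1"
  then show "time_one_flow S (D_field q) x y"
    using integral_curve_on_D_flow[of "{0..1}" q x S] by (auto simp: time_one_flow_def)
qed

text \<open>For real \<open>q\<close> the flow is a real translation composed with scaling by a
  positive real, so the imaginary part stays positive.\<close>

lemma D_flow_in_hyperbolic_plane:
  assumes "q \<in> \<real>" "x \<in> hyperbolic_plane"
  shows "D_flow q x t \<in> hyperbolic_plane"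
proof -
  obtain r where r: "q = of_real r"
    using assms(1) by (auto elim: Reals_cases)
  have e: "exp (of_real t * (q - 1)) = of_real (exp (t * (r - 1)))"
    unfolding r by (simp flip: exp_of_real)
  \<comment> \<open>Valid at \<open>r = 1\<close> too, where both sides are 0.\<close>
  have f: "1 / (q - 1) = of_real (1 / (r - 1))"
    unfolding r by simp
  show ?thesis
    using assms(2) unfolding D_flow_def affine_map_def e f
    by (auto simp: hyperbolic_plane_def)
qed

section \<open>First order expansion and the limit at q = 1\<close>

text \<open>Only the multiplier varies with \<open>h\<close>: the value at 0 is \<open>x\<close>,
  the slope is \<open>x + 1/(q-1)\<close>, and the factor \<open>q - 1\<close> cancels the
  pole.\<close>

lemma taylor_polynomial_affine_map:
  assumes "q \<noteq> (1::complex)"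
  shows "taylor_polynomial 1 (\<lambda>h. affine_map q (exp h) x) 0 (q - 1) = T_map q x"
proof -
  have "deriv (\<lambda>h. affine_map q (exp h) x) 0 = x + 1 / (q - 1)"
    unfolding affine_map_def by (rule DERIV_imp_deriv) (auto intro!: derivative_eq_intros)
  then have "taylor_polynomial 1 (\<lambda>h. affine_map q (exp h) x) 0 (q - 1) =
      affine_map q 1 x + (x + 1 / (q - 1)) * (q - 1)"
    by (simp add: taylor_polynomial_def)
  also have "\<dots> = T_map q x"
    using assms by (simp add: affine_map_def T_map_def distrib_right) (simp add: algebra_simps)
  finally show ?thesis .
qed

text \<open>The singularity at \<open>q = 1\<close> is removable: by
  \<open>full_expansion_order_one\<close> the difference from \<open>T_map\<close>, divided by
  \<open>h\<close>, has a finite limit, so the difference itself tends to 0.\<close>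

lemma affine_map_tendsto_T_map:
  fixes x :: complex
  shows "((\<lambda>r. affine_map r (exp (r - 1)) x) \<longlongrightarrow> T_map 1 x) (at 1)"
proof -
  let ?A = "\<lambda>h. affine_map (1 + h) (exp h) x" and ?T = "\<lambda>h. T_map (1 + h) x"
  have "((\<lambda>h. (?A h - ?T h) / h * h + ?T h) \<longlongrightarrow> 1 / 2 * 0 + T_map (1 + 0) x) (at 0)"
    unfolding T_map_def
    by (intro tendsto_intros full_expansion_order_one[of x, unfolded T_map_def])
  then have "(?A \<longlongrightarrow> 1 / 2 * 0 + T_map (1 + 0) x) (at 0)"
    \<comment> \<open>Cancelling \<open>h\<close> is legitimate off 0, which suffices for a
      punctured limit.\<close>
    by (rule Lim_transform_eventually) (auto simp: eventually_at_filter)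
  then show ?thesis
    by (simp add: LIM_offset_zero_iff[of 1])
qed

section \<open>The flow for a formal parameter\<close>

text \<open>Multiplication by \<open>fps_X\<close> shifts coefficients, which is what makes the
  formal equation triangular.\<close>

lemma fps_nth_D_field:
  "fps_nth (D_field (1 + fps_X) g) n = (if n = 0 then 1 else fps_nth g (n - 1))"
  by (simp add: D_field_def)

text \<open>The expansion in h of \<open>x * exp (t * h) + (exp (t * h) - 1) / h\<close>, that is,
  the affine formula with its pole cancelled.\<close>

definition formal_D_flow :: "complex \<Rightarrow> real \<Rightarrow> complex fps" where
  "formal_D_flow x t = Abs_fps (\<lambda>n. x * of_real t ^ n / fact n + of_real t ^ Suc n / fact (Suc n))"

lemma formal_integral_curve_formal_D_flow:
  "formal_integral_curve (D_field (1 + fps_X)) (fps_const x) (formal_D_flow x)"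
proof -
  have pow: "((\<lambda>s. of_real s ^ Suc n / fact (Suc n)) has_vector_derivative
      (of_real t ^ n / fact n :: complex)) (at t)" for t n
  proof (rule has_vector_derivative_real_field)
    show "((\<lambda>z::complex. z ^ Suc n / fact (Suc n)) has_field_derivative z ^ n / fact n) (at z)" for z
      using DERIV_cdivide[OF DERIV_power[OF DERIV_ident[of "at z"], of "Suc n"], of "fact (Suc n)"]
      by (simp add: fact_Suc del: of_nat_Suc power_Suc)
  qed
  have "((\<lambda>s. fps_nth (formal_D_flow x s) n) has_vector_derivative
      fps_nth (D_field (1 + fps_X) (formal_D_flow x t)) n) (at t)" for t n
  proof (cases n)
    case 0
    have "((\<lambda>s. x + of_real s) has_vector_derivative 1) (at t)"
      by (rule has_vector_derivative_real_field) (auto intro!: derivative_eq_intros)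
    then show ?thesis
      using 0 by (simp add: formal_D_flow_def fps_nth_D_field)
  next
    case (Suc m)
    show ?thesis
      using has_vector_derivative_add[OF has_vector_derivative_mult_right[OF pow[of m t], of x]
          pow[of "Suc m" t]]
      unfolding Suc fps_nth_D_field formal_D_flow_def
      by (simp del: fact_Suc power_Suc)
  qed
  moreover have "formal_D_flow x 0 = fps_const x"
    by (rule fps_ext) (simp add: formal_D_flow_def)
  ultimately show ?thesis
    by (simp add: formal_integral_curve_def)
qed

text \<open>Induction on the coefficient index: once the coefficients at \<open>n\<close> agree for
  all times, those at \<open>Suc n\<close> have equal derivatives and equal initial values.\<close>

lemma formal_integral_curve_D_field_unique:
  assumes "formal_integral_curve (D_field (1 + fps_X)) g \<gamma>"
    and "formal_integral_curve (D_field (1 + fps_X)) g \<delta>"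
  shows "\<gamma> = \<delta>"
proof -
  have d: "((\<lambda>s. fps_nth (\<epsilon> s) n) has_vector_derivative
      (if n = 0 then 1 else fps_nth (\<epsilon> s) (n - 1))) (at s)"
    if "formal_integral_curve (D_field (1 + fps_X)) g \<epsilon>" for \<epsilon> n s
    using that by (simp add: formal_integral_curve_def fps_nth_D_field)
  have "fps_nth (\<gamma> t) n = fps_nth (\<delta> t) n" for n t
  proof (induction n arbitrary: t)
    case (0 t)
    \<comment> \<open>The coefficient at 0 has derivative 1, a linear equation with
      \<open>a = 1\<close> and \<open>c = 0\<close>.\<close>
    show ?case
      using d[OF assms(1), of 0] d[OF assms(2), of 0] assms
      by (intro linear_ode_unique_on[of UNIV t "\<lambda>s. fps_nth (\<gamma> s) 0" 1 0])
        (auto simp: formal_integral_curve_def)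
  next
    case (Suc n t)
    let ?g = "\<lambda>s. fps_nth (\<gamma> s) (Suc n) - fps_nth (\<delta> s) (Suc n)"
    have "(?g has_vector_derivative 0) (at s)" for s
      using has_vector_derivative_diff[OF d[OF assms(1), of "Suc n" s] d[OF assms(2), of "Suc n" s]] Suc.IH by simp
    then obtain k where "\<And>s. ?g s = k"
      using has_vector_derivative_zero_constant[of UNIV ?g] by auto
    then have "?g t = ?g 0" by simp
    then show ?case
      using assms by (simp add: formal_integral_curve_def)
  qed
  then show ?thesis
    by (simp add: fun_eq_iff fps_eq_iff)
qed

text \<open>\<open>fps_X\<close> becomes invertible only among Laurent series, so the premise is the
  identity with denominators cleared. It is applied to the exponential and to its
  truncation.\<close>

lemma fps_to_fls_eq_affine_map:
  fixes x :: "'a::field"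
  assumes "fps_X * g = (1 + fps_const x * fps_X) * e - 1"
  shows "fps_to_fls g = affine_map (1 + fls_X) (fps_to_fls e) (fls_const x)"
proof -
  have "fls_X * fps_to_fls g = (1 + fls_const x * fls_X) * fps_to_fls e - 1"
    using arg_cong[OF assms, of fps_to_fls]
    by (simp add: fls_times_fps_to_fls fps_to_fls_plus fps_to_fls_minus)
  then show ?thesis
    by (intro affine_map_eqI) simp_all
qed

lemma formal_D_flow_1:
  "fps_to_fls (formal_D_flow x 1) =
     affine_map (1 + fls_X) (fps_to_fls (fps_exp 1)) (fls_const x)"
proof (rule fps_to_fls_eq_affine_map, rule fps_ext)
  fix n
  show "fps_nth (fps_X * formal_D_flow x 1) n =
      fps_nth ((1 + fps_const x * fps_X) * fps_exp 1 - 1) n"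
    \<comment> \<open>At \<open>n = 0\<close> both sides are 0; at \<open>Suc m\<close> both are
      \<open>x / fact m + 1 / fact (Suc m)\<close>.\<close>
    by (cases n) (simp_all add: formal_D_flow_def distrib_right mult.assoc)
qed

text \<open>\<open>fps_cutoff 2\<close> keeps the degrees 0 and 1, so the multiplier becomes
  \<open>1 + h\<close>, and
  \<open>(1 + x * h) * (1 + h) - 1 = h * ((1 + h) * x + 1)\<close>.\<close>

lemma affine_map_cutoff_exp:
  "affine_map (1 + fls_X) (fps_to_fls (fps_cutoff 2 (fps_exp 1))) (fls_const x) =
     T_map (1 + fls_X) (fls_const (x :: complex))"
proof -
  have "fps_cutoff 2 (fps_exp 1) = (1 + fps_X :: complex fps)"
    by (rule fps_ext) (auto simp: fps_cutoff_def fps_X_def less_2_cases_iff)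
  then have "fps_to_fls ((1 + fps_X) * fps_const x + 1) =
      affine_map (1 + fls_X) (fps_to_fls (fps_cutoff 2 (fps_exp 1))) (fls_const x)"
    by (intro fps_to_fls_eq_affine_map) (simp add: algebra_simps)
  then show ?thesis
    by (simp add: T_map_def fls_times_fps_to_fls)
qed

theorem proposition4p1:
  fixes q :: complex
  assumes "q \<noteq> 0"
  shows
    "(\<forall>x. \<exists>!\<gamma>. integral_curve_on UNIV UNIV (D_field q) x \<gamma>) \<and>
     (q \<noteq> 1 \<longrightarrow>
        (\<forall>x y. time_one_flow UNIV (D_field q) x y \<longleftrightarrow> y = affine_map q (exp (q - 1)) x) \<and>
        (\<forall>x\<in>hyperbolic_plane. \<forall>y. time_one_flow hyperbolic_plane (D_field q) x y \<longleftrightarrow>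
            (\<forall>t\<in>{0..1}. affine_map q (exp (of_real t * (q - 1))) x \<in> hyperbolic_plane) \<and>
            y = affine_map q (exp (q - 1)) x) \<and>
        (q \<in> \<real> \<longrightarrow> (\<forall>x\<in>hyperbolic_plane. \<forall>y.
            time_one_flow hyperbolic_plane (D_field q) x y \<longleftrightarrow>
            y = affine_map q (exp (q - 1)) x)) \<and>
        (\<forall>x. taylor_polynomial 1 (\<lambda>h. affine_map q (exp h) x) 0 (q - 1) = T_map q x)) \<and>
     (q = 1 \<longrightarrow>
        (\<forall>x y. time_one_flow UNIV (D_field q) x y \<longleftrightarrow> y = T_map q x) \<and>
        (\<forall>x\<in>hyperbolic_plane. \<forall>y.
            time_one_flow hyperbolic_plane (D_field q) x y \<longleftrightarrow> y = T_map q x) \<and>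
        (\<forall>x. ((\<lambda>r. affine_map r (exp (r - 1)) x) \<longlongrightarrow> T_map q x) (at q))) \<and>
     (\<forall>x. (\<exists>!\<gamma>. formal_integral_curve (D_field (1 + fps_X)) (fps_const x) \<gamma>) \<and>
        (\<forall>\<gamma>. formal_integral_curve (D_field (1 + fps_X)) (fps_const x) \<gamma> \<longrightarrow>
            fps_to_fls (\<gamma> 1) =
              affine_map (1 + fls_X) (fps_to_fls (fps_exp 1)) (fls_const x)) \<and>
        affine_map (1 + fls_X) (fps_to_fls (fps_cutoff 2 (fps_exp 1))) (fls_const x) =
          T_map (1 + fls_X) (fls_const (x :: complex)))"
proof (intro conjI impI allI)
  fix x
  show "\<exists>!\<gamma>. integral_curve_on UNIV UNIV (D_field q) x \<gamma>"
    by (rule ex1I[of _ "D_flow q x"])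
      (auto intro: integral_curve_on_D_flow integral_curve_on_D_field_unique[of UNIV])
next
  fix x y
  assume "q \<noteq> 1"
  then show "time_one_flow UNIV (D_field q) x y \<longleftrightarrow> y = affine_map q (exp (q - 1)) x"
    by (simp add: time_one_flow_D_field_iff D_flow_1)
next
  assume "q \<noteq> 1"
  then show "\<forall>x\<in>hyperbolic_plane. \<forall>y. time_one_flow hyperbolic_plane (D_field q) x y \<longleftrightarrow>
      (\<forall>t\<in>{0..1}. affine_map q (exp (of_real t * (q - 1))) x \<in> hyperbolic_plane) \<and>
      y = affine_map q (exp (q - 1)) x"
    by (simp add: time_one_flow_D_field_iff D_flow_def)
next
  assume "q \<noteq> 1" "q \<in> \<real>"
  then show "\<forall>x\<in>hyperbolic_plane. \<forall>y. time_one_flow hyperbolic_plane (D_field q) x y \<longleftrightarrow>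
      y = affine_map q (exp (q - 1)) x"
    by (simp add: time_one_flow_D_field_iff D_flow_1 D_flow_in_hyperbolic_plane)
next
  fix x
  assume "q \<noteq> 1"
  then show "taylor_polynomial 1 (\<lambda>h. affine_map q (exp h) x) 0 (q - 1) = T_map q x"
    by (rule taylor_polynomial_affine_map)
next
  fix x y
  assume "q = 1"
  then show "time_one_flow UNIV (D_field q) x y \<longleftrightarrow> y = T_map q x"
    by (simp add: time_one_flow_D_field_iff D_flow_def T_map_def)
next
  assume "q = 1"
  then show "\<forall>x\<in>hyperbolic_plane. \<forall>y.
      time_one_flow hyperbolic_plane (D_field q) x y \<longleftrightarrow> y = T_map q x"
    \<comment> \<open>Membership in the half-plane is settled while \<open>D_flow\<close> is still
      folded; only then is its value at time 1 computed.\<close>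
    using D_flow_in_hyperbolic_plane[of q]
    by (simp add: time_one_flow_D_field_iff) (simp add: D_flow_def T_map_def)
next
  fix x
  assume "q = 1"
  then show "((\<lambda>r. affine_map r (exp (r - 1)) x) \<longlongrightarrow> T_map q x) (at q)"
    using affine_map_tendsto_T_map by simp
next
  fix x
  show "\<exists>!\<gamma>. formal_integral_curve (D_field (1 + fps_X)) (fps_const x) \<gamma>"
    using formal_integral_curve_formal_D_flow formal_integral_curve_D_field_unique by blast
next
  fix x \<gamma>
  assume "formal_integral_curve (D_field (1 + fps_X)) (fps_const x) \<gamma>"
  then have "\<gamma> = formal_D_flow x"
    using formal_integral_curve_formal_D_flow formal_integral_curve_D_field_unique by blast
  then show "fps_to_fls (\<gamma> 1) = affine_map (1 + fls_X) (fps_to_fls (fps_exp 1)) (fls_const x)"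
    by (simp add: formal_D_flow_1)
next
  fix x :: complex
  show "affine_map (1 + fls_X) (fps_to_fls (fps_cutoff 2 (fps_exp 1))) (fls_const x) =
      T_map (1 + fls_X) (fls_const x)"
    by (rule affine_map_cutoff_exp)
qed

end
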